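(* Suppose that $F$ is a distribution on $\mathbb{R}$ satisfying $\int_0^\infty(1-F(x))^{1/d}\,dx<\infty$, and such that $X_{\mathbf{0}}$ is bounded below. Then $G\le LN$ almost surely.
   Context: Fix $d\ge2$. $\{X_{\mathbf{v}}:\mathbf{v}\in\mathbb{Z}^d\}$ are independent real random variables with common distribution (function) $F$. A lattice animal is a finite non-empty connected (nearest-neighbour) set of sites $\xi\subset\mathbb{Z}^d$; $|\xi|$ is its number of sites and $S(\xi)=\sum_{\mathbf{v}\in\xi}X_{\mathbf{v}}$ its weight. $N_n$ is the maximal weight among lattice animals of size $n$ containing the origin $\mathbf{0}$. Under the stated integral condition, $n^{-1}N_n$ converges almost surely to a non-random finite constant, denoted $N$ (known result). With $B_n=\{0,\ldots,n-1\}^d$, set $G_n=\max\{S(\xi):\xi\text{ a lattice animal},\ \xi\subseteq B_n\}$ and $L_n=\min\{|\xi|:\xi\text{ a lattice animal},\ \xi\subseteq B_n,\ S(\xi)=G_n\}$. Under the stated integral condition, $n^{-d}G_n$ converges almost surely to a non-random finite constant, denoted $G$. Finally $L=\liminf_{n\to\infty}n^{-d}L_n$, which may a priori be random. *)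

theory Defs
  imports "HOL-Probability.Probability"
begin

text \<open>
  The lattice \<open>\<int>\<^sup>d\<close> is the type \<open>int ^ 'd\<close> with \<open>d = CARD('d)\<close>. All quantities below are functions
  of a fixed configuration \<open>x\<close> of site weights; randomness enters by taking
  \<open>x = (\<lambda>v. X v \<omega>)\<close>.
\<close>

type_synonym 'd site = "int ^ 'd"

definition nearest_nbr :: "'d::finite site \<Rightarrow> 'd site \<Rightarrow> bool" where
  "nearest_nbr u v \<longleftrightarrow> (\<Sum>i\<in>UNIV. \<bar>u $ i - v $ i\<bar>) = 1"

definition connected_sites :: "'d::finite site set \<Rightarrow> bool" where
  "connected_sites \<xi> \<longleftrightarrow>
     (\<forall>u\<in>\<xi>. \<forall>v\<in>\<xi>. (u, v) \<in> {(a, b). a \<in> \<xi> \<and> b \<in> \<xi> \<and> nearest_nbr a b}\<^sup>*)"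

definition lattice_animal :: "'d::finite site set \<Rightarrow> bool" where
  "lattice_animal \<xi> \<longleftrightarrow> finite \<xi> \<and> \<xi> \<noteq> {} \<and> connected_sites \<xi>"

definition weight :: "('d::finite site \<Rightarrow> real) \<Rightarrow> 'd site set \<Rightarrow> real" where
  "weight x \<xi> = (\<Sum>v\<in>\<xi>. x v)"

definition lattice_box :: "nat \<Rightarrow> 'd::finite site set" where
  "lattice_box n = {v. \<forall>i. 0 \<le> v $ i \<and> v $ i < int n}"

text \<open>
  For \<open>n = 0\<close> the sets under \<open>Max\<close> and \<open>Min\<close> below are empty and the values are
  unspecified; only limits as \<open>n \<rightarrow> \<infinity>\<close> are used.
\<close>

definition greedy_weight :: "('d::finite site \<Rightarrow> real) \<Rightarrow> nat \<Rightarrow> real" where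
  "greedy_weight x n = Max {weight x \<xi> | \<xi>. lattice_animal \<xi> \<and> 0 \<in> \<xi> \<and> card \<xi> = n}"

definition box_weight :: "('d::finite site \<Rightarrow> real) \<Rightarrow> nat \<Rightarrow> real" where
  "box_weight x n = Max {weight x \<xi> | \<xi>. lattice_animal \<xi> \<and> \<xi> \<subseteq> lattice_box n}"

definition box_min_size :: "('d::finite site \<Rightarrow> real) \<Rightarrow> nat \<Rightarrow> nat" where
  "box_min_size x n =
     Min {card \<xi> | \<xi>. lattice_animal \<xi> \<and> \<xi> \<subseteq> lattice_box n \<and> weight x \<xi> = box_weight x n}"

text \<open>The liminf is taken in \<open>ereal\<close>, a complete lattice; its value always lies in \<open>[0, 1]\<close>.\<close>

definition box_density :: "('d::finite site \<Rightarrow> real) \<Rightarrow> ereal" where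
  "box_density x = liminf (\<lambda>n. ereal (real (box_min_size x n) / real n ^ CARD('d)))"

end

theory Submission
  imports Defs "HOL-Real_Asymp.Real_Asymp"
begin

text \<open>
  Every lattice animal in the box \<open>B\<^sub>n\<close> can be joined to the origin by a union of at most \<open>d\<close> axis-parallel
  lines of \<open>n\<close> sites each (lemma \<open>coordinate_lines_to_point\<close>). Applied to a smallest animal of maximal
  weight \<open>G\<^sub>n\<close>, this yields an animal that contains the origin and whose size \<open>m\<close> satisfies
  \<open>L\<^sub>n \<le> m \<le> L\<^sub>n + dn + 1\<close>. As the site weights are at least some \<open>b \<le> 0\<close>, the added sites
  cost at most \<open>\<bar>b\<bar> (dn + 1)\<close>, so that
  \<open>G\<^sub>n + b (dn + 1) \<le> N\<^sub>m\<close>.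
  Since \<open>d \<ge> 2\<close>, the terms of order \<open>n\<close> vanish after division by \<open>n\<^sup>d\<close>. The lines also force \<open>m \<ge> n\<close>, so
  \<open>m \<rightarrow> \<infinity>\<close> and \<open>N\<^sub>m / m \<rightarrow> N\<close> even when \<open>L\<^sub>n\<close> stays bounded. Along a subsequence on which
  \<open>n\<^sup>-\<^sup>d L\<^sub>n\<close> tends to its lower limit \<open>L\<close> one has \<open>m / n\<^sup>d \<rightarrow> L\<close>, and writing
  \<open>N\<^sub>m / n\<^sup>d\<close> as \<open>(m / n\<^sup>d) (N\<^sub>m / m)\<close> gives \<open>G \<le> L N\<close>.

  The argument is carried out for a fixed configuration bounded below at every site. Almost every
  configuration is of this kind, because the weights are identically distributed and there are only
  countably many sites.
\<close>

section \<open>Connected sets of sites\<close>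

lemma nearest_nbr_commute: "nearest_nbr u v \<longleftrightarrow> nearest_nbr v u"
  by (simp add: nearest_nbr_def abs_minus_commute)

lemma connected_sites_Un:
  assumes A: "connected_sites A" and B: "connected_sites B" and z: "z \<in> A" "z \<in> B"
  shows "connected_sites (A \<union> B)"
proof -
  let ?R = "\<lambda>C. {(a, b). a \<in> C \<and> b \<in> C \<and> nearest_nbr a b}"
  have sub: "(?R A)\<^sup>* \<subseteq> (?R (A \<union> B))\<^sup>*" "(?R B)\<^sup>* \<subseteq> (?R (A \<union> B))\<^sup>*"
    by (intro rtrancl_mono; auto)+
  have "(u, z) \<in> (?R (A \<union> B))\<^sup>* \<and> (z, u) \<in> (?R (A \<union> B))\<^sup>*" if "u \<in> A \<union> B" for u
    using that A B z sub unfolding connected_sites_def by blast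
  then show ?thesis
    unfolding connected_sites_def by (meson rtrancl_trans)
qed

lemma connected_sites_walk:
  assumes step: "\<And>k. nearest_nbr (p k) (p (Suc k))"
  shows "connected_sites (p ` {..<n::nat})"
proof -
  let ?R = "{(a, b). a \<in> p ` {..<n} \<and> b \<in> p ` {..<n} \<and> nearest_nbr a b}"
  have sym: "sym (?R\<^sup>*)"
    by (rule sym_rtrancl) (auto simp: sym_def nearest_nbr_commute)
  have up: "j < n \<Longrightarrow> (p i, p j) \<in> ?R\<^sup>*" if "i \<le> j" for i j
    using that
  proof (induction j rule: dec_induct)
    case base
    show ?case by simp
  next
    case (step k)
    then have "(p k, p (Suc k)) \<in> ?R"
      using assms by auto
    with step show ?case
      by (meson Suc_lessD rtrancl.rtrancl_into_rtrancl)
  qed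
  have "(p i, p j) \<in> ?R\<^sup>*" if "i < n" "j < n" for i j
    using up[of i j] up[of j i] that sym by (meson nat_le_linear symD)
  then show ?thesis
    unfolding connected_sites_def by auto
qed

lemma nearest_nbr_axis_step:
  fixes u :: "'d::finite site"
  shows "nearest_nbr (u + axis i (int k)) (u + axis i (int (Suc k)))"
proof -
  have "(\<Sum>j\<in>UNIV. \<bar>(u + axis i (int k)) $ j - (u + axis i (int (Suc k))) $ j\<bar>)
      = (\<Sum>j\<in>UNIV. if j = i then 1 else 0)"
    by (rule sum.cong) (auto simp: axis_def)
  then show ?thesis
    by (simp add: nearest_nbr_def)
qed

text \<open>
  The coordinates of \<open>v\<close> are switched on one at a time. Each new coordinate contributes a line
  across the whole box and not merely the segment up to \<open>v\<close>: this makes the set large as well as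
  small, and so the size of the joined animals is forced to infinity.
\<close>

lemma coordinate_lines_to_point:
  fixes v :: "'d::finite site"
  assumes v: "v \<in> lattice_box n"
  shows "\<exists>P. finite P \<and> connected_sites P \<and> 0 \<in> P \<and> (\<chi> j. if j \<in> A then v $ j else 0) \<in> P
           \<and> card P \<le> Suc (card A * n) \<and> (A \<noteq> {} \<longrightarrow> n \<le> card P)"
proof (induction A rule: finite_induct[OF finite])
  case 1
  have "(\<chi> j. if j \<in> {} then v $ j else 0) = (0 :: 'd site)"
    by (simp add: vec_eq_iff)
  then show ?case
    by (intro exI[of _ "{0}"]) (simp add: connected_sites_def)
next
  case (2 i A)
  define u where "u = (\<chi> j. if j \<in> A then v $ j else 0)"
  from "2.IH" obtain P where P: "finite P" "connected_sites P" "0 \<in> P" "u \<in> P"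
    "card P \<le> Suc (card A * n)"
    unfolding u_def by blast
  define p where "p = (\<lambda>k. u + axis i (int k))"
  define Q where "Q = p ` {..<n}"
  have vi: "0 \<le> v $ i" "v $ i < int n"
    using v by (auto simp: lattice_box_def)
  have uQ: "u \<in> Q"
    unfolding Q_def p_def using vi by (intro image_eqI[of _ _ 0]) (auto simp: vec_eq_iff axis_def)
  have "(\<chi> j. if j \<in> insert i A then v $ j else 0) = p (nat (v $ i))"
    using vi 2(2) by (auto simp: p_def u_def vec_eq_iff axis_def)
  then have vQ: "(\<chi> j. if j \<in> insert i A then v $ j else 0) \<in> Q"
    unfolding Q_def using vi by (metis imageI lessThan_iff nat_less_iff)
  have "inj p"
    by (rule injI) (auto simp: p_def axis_eq_axis)
  then have cardQ: "card Q = n"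
    by (simp add: Q_def card_image inj_on_subset)
  have conn: "connected_sites (P \<union> Q)"
    unfolding Q_def
    by (rule connected_sites_Un[OF P(2) connected_sites_walk P(4) uQ[unfolded Q_def]])
      (simp only: p_def nearest_nbr_axis_step)
  have fQ: "finite Q"
    by (simp add: Q_def)
  have "card (P \<union> Q) \<le> Suc (card (insert i A) * n)"
    using card_Un_le[of P Q] P(5) cardQ 2(2) 2(1) by simp
  moreover have "n \<le> card (P \<union> Q)"
    using card_mono[of "P \<union> Q" Q] P(1) fQ cardQ by simp
  ultimately show ?case
    using P fQ vQ conn by (intro exI[of _ "P \<union> Q"]) auto
qed

section \<open>The extremal quantities are attained\<close>

lemma finite_bounded_sites: "finite {v :: 'd::finite site. \<forall>i. v $ i \<in> {a..<b}}"
  and card_bounded_sites: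
    "card {v :: 'd::finite site. \<forall>i. v $ i \<in> {a..<b}} = nat (b - a) ^ CARD('d)"
proof -
  have inj: "inj (vec_lambda :: ('d \<Rightarrow> int) \<Rightarrow> 'd site)"
    by (simp add: inj_def vec_lambda_inject)
  have eq: "{v :: 'd site. \<forall>i. v $ i \<in> {a..<b}} = vec_lambda ` (UNIV \<rightarrow>\<^sub>E {a..<b})"
    by (force simp: PiE_def Pi_def extensional_def intro!: image_eqI[of _ _ "vec_nth _"])
  show "finite {v :: 'd site. \<forall>i. v $ i \<in> {a..<b}}"
    unfolding eq by (intro finite_imageI finite_PiE) auto
  show "card {v :: 'd site. \<forall>i. v $ i \<in> {a..<b}} = nat (b - a) ^ CARD('d)"
    unfolding eq using inj by (simp add: card_image inj_on_subset card_PiE)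
qed

lemma lattice_box_eq: "lattice_box n = {v :: 'd::finite site. \<forall>i. v $ i \<in> {0..<int n}}"
  by (auto simp: lattice_box_def)

lemma finite_lattice_box: "finite (lattice_box n :: 'd::finite site set)"
  by (simp only: lattice_box_eq finite_bounded_sites)

lemma card_lattice_box: "card (lattice_box n :: 'd::finite site set) = n ^ CARD('d)"
  by (simp only: lattice_box_eq card_bounded_sites) simp

lemma nearest_nbr_coordinate:
  assumes "nearest_nbr u v"
  shows "\<bar>u $ i - v $ i\<bar> \<le> 1"
proof -
  have "\<bar>u $ i - v $ i\<bar> \<le> (\<Sum>j\<in>UNIV. \<bar>u $ j - v $ j\<bar>)"
    by (rule member_le_sum) auto
  then show ?thesis
    using assms by (simp add: nearest_nbr_def)
qed

text \<open>
  The crude radius \<open>n\<^sup>2\<close> comes from bounding the length of a path in an animal by the number of its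
  ordered pairs of sites; any bound depending on \<open>n\<close> alone gives finiteness.
\<close>

lemma finite_animals_at_origin:
  "finite {\<xi> :: 'd::finite site set. lattice_animal \<xi> \<and> 0 \<in> \<xi> \<and> card \<xi> = n}"
proof (rule finite_subset)
  let ?K = "{v :: 'd site. \<forall>i. v $ i \<in> {- int (n * n)..<int (n * n) + 1}}"
  show "finite (Pow ?K)"
    by (simp only: finite_Pow_iff finite_bounded_sites)
  show "{\<xi> :: 'd site set. lattice_animal \<xi> \<and> 0 \<in> \<xi> \<and> card \<xi> = n} \<subseteq> Pow ?K"
  proof clarify
    fix \<xi> :: "'d site set" and v i
    assume \<xi>: "lattice_animal \<xi>" "0 \<in> \<xi>" "n = card \<xi>" and v: "v \<in> \<xi>"
    let ?R = "{(a, b). a \<in> \<xi> \<and> b \<in> \<xi> \<and> nearest_nbr a b}"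
    have fin: "finite \<xi>"
      using \<xi> by (simp add: lattice_animal_def)
    have sub: "?R \<subseteq> \<xi> \<times> \<xi>"
      by auto
    have fR: "finite ?R"
      using sub fin by (meson finite_SigmaI finite_subset)
    have "card ?R \<le> card (\<xi> \<times> \<xi>)"
      using sub fin by (intro card_mono) auto
    then have cR: "card ?R \<le> card \<xi> * card \<xi>"
      by (simp add: card_cartesian_product)
    have "(0, v) \<in> ?R\<^sup>*"
      using \<xi> v by (auto simp: lattice_animal_def connected_sites_def)
    then obtain k where k: "k \<le> card ?R" "(0, v) \<in> ?R ^^ k"
      unfolding rtrancl_finite_eq_relpow[OF fR] by auto
    have "\<bar>w $ i\<bar> \<le> int k" if "(0, w) \<in> ?R ^^ k" for w k
      using that
    proof (induction k arbitrary: w)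
      case (Suc k)
      then obtain y where y: "(0, y) \<in> ?R ^^ k" "nearest_nbr y w"
        by auto
      with Suc.IH nearest_nbr_coordinate[OF y(2), of i] show ?case
        by force
    qed simp
    from this[OF k(2)] k(1) cR have "\<bar>v $ i\<bar> \<le> int (card \<xi> * card \<xi>)"
      by linarith
    then show "v $ i \<in> {- int (card \<xi> * card \<xi>)..<int (card \<xi> * card \<xi>) + 1}"
      by (simp only: atLeastLessThan_iff) linarith
  qed
qed

lemma weight_le_greedy_weight:
  assumes "lattice_animal \<xi>" "0 \<in> \<xi>"
  shows "weight x \<xi> \<le> greedy_weight x (card \<xi>)"
  unfolding greedy_weight_def
proof (rule Max_ge)
  have "finite (weight x ` {\<eta>. lattice_animal \<eta> \<and> 0 \<in> \<eta> \<and> card \<eta> = card \<xi>})"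
    by (intro finite_imageI finite_animals_at_origin)
  then show "finite {weight x \<eta> |\<eta>. lattice_animal \<eta> \<and> 0 \<in> \<eta> \<and> card \<eta> = card \<xi>}"
    by (simp add: image_Collect)
qed (use assms in auto)

lemma smallest_optimal_animal:
  fixes x :: "'d::finite site \<Rightarrow> real"
  assumes "n > 0"
  obtains \<xi> where "lattice_animal \<xi>" "\<xi> \<subseteq> lattice_box n" "weight x \<xi> = box_weight x n"
    "card \<xi> = box_min_size x n"
proof -
  let ?A = "{\<xi> :: 'd site set. lattice_animal \<xi> \<and> \<xi> \<subseteq> lattice_box n}"
  have finA: "finite ?A"
    by (rule finite_subset[of _ "Pow (lattice_box n)"]) (auto simp: finite_lattice_box)
  have "{0} \<in> ?A"
    using assms by (simp add: lattice_animal_def connected_sites_def lattice_box_def)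
  then have ne: "?A \<noteq> {}"
    by blast
  have bw: "box_weight x n = Max (weight x ` ?A)"
    by (simp add: box_weight_def image_Collect)
  have "box_weight x n \<in> weight x ` ?A"
    unfolding bw using finA ne by (intro Max_in) auto
  then obtain \<zeta> where \<zeta>: "\<zeta> \<in> ?A" "weight x \<zeta> = box_weight x n"
    by auto
  let ?B = "{\<xi> \<in> ?A. weight x \<xi> = box_weight x n}"
  have bm: "box_min_size x n = Min (card ` ?B)"
    unfolding box_min_size_def by (rule arg_cong[of _ _ Min]) auto
  have "finite ?B"
    by (rule finite_subset[OF _ finA]) auto
  then have "box_min_size x n \<in> card ` ?B"
    unfolding bm using \<zeta> by (intro Min_in) auto
  then show ?thesis
    using that by auto
qed

lemma box_min_size_le: "n > 0 \<Longrightarrow> box_min_size (x :: 'd::finite site \<Rightarrow> real) n \<le> n ^ CARD('d)"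
  by (metis smallest_optimal_animal card_lattice_box card_mono finite_lattice_box)

section \<open>Comparison of the box with the origin\<close>

text \<open>
  The animal behind \<open>m\<close> is a smallest optimal one of the box together with the coordinate lines
  leading to one of its sites. How many of the line sites are new is not known, only that there are at
  most \<open>dn + 1\<close>; a nonpositive \<open>b\<close> makes the estimate with this largest number valid for any smaller one.
\<close>

lemma box_weight_le_greedy_weight:
  fixes x :: "'d::finite site \<Rightarrow> real"
  assumes n: "n > 0" and b: "\<And>v. b \<le> x v" "b \<le> 0"
  obtains m where "n \<le> m" "box_min_size x n \<le> m" "m \<le> box_min_size x n + Suc (CARD('d) * n)"
    "box_weight x n + b * real (Suc (CARD('d) * n)) \<le> greedy_weight x m"
proof -
  obtain \<xi> where \<xi>: "lattice_animal \<xi>" "\<xi> \<subseteq> lattice_box n" "weight x \<xi> = box_weight x n"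
    "card \<xi> = box_min_size x n"
    using smallest_optimal_animal[OF n] .
  have fin: "finite \<xi>"
    using \<xi>(1) by (simp add: lattice_animal_def)
  obtain v where v: "v \<in> \<xi>"
    using \<xi>(1) by (auto simp: lattice_animal_def)
  then have "v \<in> lattice_box n"
    using \<xi>(2) by auto
  from coordinate_lines_to_point[OF this, of UNIV]
  obtain P where P: "finite P" "connected_sites P" "0 \<in> P" "v \<in> P"
    "card P \<le> Suc (CARD('d) * n)" "n \<le> card P"
    by auto
  have animal: "lattice_animal (\<xi> \<union> P)"
    using \<xi>(1) fin P v connected_sites_Un[of \<xi> P v] by (auto simp: lattice_animal_def)
  have "real (card (P - \<xi>)) \<le> real (Suc (CARD('d) * n))"
    using card_mono[OF P(1), of "P - \<xi>"] P(5) unfolding of_nat_le_iff by auto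
  then have "b * real (Suc (CARD('d) * n)) \<le> b * real (card (P - \<xi>))"
    using b(2) by (rule mult_left_mono_neg)
  also have "\<dots> \<le> weight x (P - \<xi>)"
    using sum_bounded_below[of "P - \<xi>" b x] b(1) by (simp add: weight_def mult.commute)
  finally have "box_weight x n + b * real (Suc (CARD('d) * n)) \<le> weight x \<xi> + weight x (P - \<xi>)"
    using \<xi>(3) by simp
  also have "\<dots> = weight x (\<xi> \<union> P)"
    using sum.union_disjoint[of \<xi> "P - \<xi>" x] fin P(1) by (simp add: weight_def)
  also have "\<dots> \<le> greedy_weight x (card (\<xi> \<union> P))"
    using animal P(3) by (intro weight_le_greedy_weight) auto
  finally have w: "box_weight x n + b * real (Suc (CARD('d) * n)) \<le> greedy_weight x (card (\<xi> \<union> P))" .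
  show ?thesis
  proof (rule that[OF _ _ _ w])
    show "n \<le> card (\<xi> \<union> P)"
      using card_mono[of "\<xi> \<union> P" P] fin P by simp
    show "box_min_size x n \<le> card (\<xi> \<union> P)"
      using card_mono[of "\<xi> \<union> P" \<xi>] fin P \<xi>(4) by simp
    show "card (\<xi> \<union> P) \<le> box_min_size x n + Suc (CARD('d) * n)"
      using card_Un_le[of \<xi> P] P(5) \<xi>(4) by simp
  qed
qed

text \<open>The line sites are negligible on the scale of the volume in dimension at least two.\<close>

lemma linear_over_volume_tendsto_0:
  assumes "d \<ge> 2"
  shows "(\<lambda>n. real (Suc (d * n)) / real n ^ d) \<longlonglongrightarrow> 0"
proof (rule tendsto_sandwich[OF _ _ tendsto_const])
  show "(\<lambda>n. (real d * real n + 1) / real n ^ 2) \<longlonglongrightarrow> 0"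
    by real_asymp
  have "real (Suc (d * n)) / real n ^ d \<le> (real d * real n + 1) / real n ^ 2" if "n > 0" for n
    using that assms power_increasing[of 2 d "real n"] by (intro frac_le) auto
  then show "\<forall>\<^sub>F n in sequentially. real (Suc (d * n)) / real n ^ d \<le> (real d * real n + 1) / real n ^ 2"
    by (intro eventually_sequentiallyI[of 1]) auto
qed simp

lemma box_density_bound_deterministic:
  fixes x :: "'d::finite site \<Rightarrow> real"
  assumes dim: "CARD('d) \<ge> 2" and b: "\<And>v. b \<le> x v"
    and N: "(\<lambda>n. greedy_weight x n / real n) \<longlonglongrightarrow> N"
    and G: "(\<lambda>n. box_weight x n / real n ^ CARD('d)) \<longlonglongrightarrow> G"
  shows "ereal G \<le> box_density x * ereal N"
proof -
  define d where "d = CARD('d)"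
  define c where "c = min b 0"
  define q where "q n = real (box_min_size x n) / real n ^ d" for n
  define e where "e n = real (Suc (d * n)) / real n ^ d" for n
  have c: "c \<le> x v" "c \<le> 0" for v
    using b[of v] by (auto simp: c_def)
  have "\<exists>m. n > 0 \<longrightarrow> n \<le> m \<and> box_min_size x n \<le> m \<and> m \<le> box_min_size x n + Suc (d * n)
          \<and> box_weight x n + c * real (Suc (d * n)) \<le> greedy_weight x m" for n
    using box_weight_le_greedy_weight[of n c x] c unfolding d_def by metis
  then obtain m where m: "\<And>n. n > 0 \<Longrightarrow> n \<le> m n \<and> box_min_size x n \<le> m n
      \<and> m n \<le> box_min_size x n + Suc (d * n)
      \<and> box_weight x n + c * real (Suc (d * n)) \<le> greedy_weight x (m n)"
    by metis
  \<comment> \<open>Boundedness makes the lower limit a real number, so that the limits below can be taken in \<open>real\<close>.\<close>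
  have q01: "0 \<le> q n \<and> q n \<le> 1" for n
  proof (cases "n = 0")
    case True
    then show ?thesis by (simp add: q_def d_def zero_power)
  next
    case False
    then have "real (box_min_size x n) \<le> real n ^ d"
      using box_min_size_le[of n x] unfolding d_def by (metis neq0_conv of_nat_le_iff of_nat_power)
    with False show ?thesis
      by (simp add: q_def)
  qed
  have dens: "box_density x = liminf (\<lambda>n. ereal (q n))"
    by (simp add: box_density_def q_def d_def)
  obtain r where r: "strict_mono r" "((\<lambda>n. ereal (q n)) \<circ> r) \<longlonglongrightarrow> box_density x"
    using liminf_subseq_lim[of "\<lambda>n. ereal (q n)"] unfolding dens by blast
  have "0 \<le> box_density x"
    by (rule LIMSEQ_le_const[OF r(2)]) (simp add: q01)
  moreover have "box_density x \<le> 1"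
    by (rule LIMSEQ_le_const2[OF r(2)]) (simp add: q01)
  ultimately obtain l where l: "box_density x = ereal l"
    by (cases "box_density x") auto
  have ql: "(\<lambda>k. q (r k)) \<longlonglongrightarrow> l"
    using r(2) by (simp add: l o_def)
  have rinf: "filterlim r sequentially sequentially"
    using r(1) by (rule filterlim_subseq)
  have rpos: "\<forall>\<^sub>F k in sequentially. r k > 0"
    by (rule eventually_compose_filterlim[OF eventually_gt_at_top rinf])
  have "e \<longlonglongrightarrow> 0"
    using linear_over_volume_tendsto_0[OF dim] by (simp add: e_def[abs_def] d_def)
  then have er: "(\<lambda>k. e (r k)) \<longlonglongrightarrow> 0"
    by (rule filterlim_compose[OF _ rinf])
  have ml: "(\<lambda>k. real (m (r k)) / real (r k) ^ d) \<longlonglongrightarrow> l"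
  proof (rule tendsto_sandwich[OF _ _ ql])
    show "(\<lambda>k. q (r k) + e (r k)) \<longlonglongrightarrow> l"
      using tendsto_add[OF ql er] by simp
    show "\<forall>\<^sub>F k in sequentially. q (r k) \<le> real (m (r k)) / real (r k) ^ d"
      using rpos
    proof eventually_elim
      case (elim k)
      have "box_min_size x (r k) \<le> m (r k)"
        using m[OF elim] by simp
      then show ?case
        unfolding q_def by (intro divide_right_mono) auto
    qed
    show "\<forall>\<^sub>F k in sequentially. real (m (r k)) / real (r k) ^ d \<le> q (r k) + e (r k)"
      using rpos
    proof eventually_elim
      case (elim k)
      have "real (m (r k)) \<le> real (box_min_size x (r k) + Suc (d * r k))"
        using m[OF elim] by (simp only: of_nat_le_iff)
      then show ?case
        unfolding q_def e_def add_divide_distrib[symmetric] by (intro divide_right_mono) auto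
    qed
  qed
  have "filterlim (\<lambda>k. m (r k)) sequentially sequentially"
  proof (rule filterlim_at_top_mono[OF rinf])
    show "\<forall>\<^sub>F k in sequentially. r k \<le> m (r k)"
      using rpos by (rule eventually_mono) (use m in simp)
  qed
  then have Nm: "(\<lambda>k. greedy_weight x (m (r k)) / real (m (r k))) \<longlonglongrightarrow> N"
    by (rule filterlim_compose[OF N])
  have lhs: "(\<lambda>k. box_weight x (r k) / real (r k) ^ d + c * e (r k)) \<longlonglongrightarrow> G + c * 0"
    by (intro tendsto_intros er filterlim_compose[OF G[folded d_def] rinf])
  have "G + c * 0 \<le> l * N"
  proof (rule tendsto_le[OF _ tendsto_mult[OF ml Nm] lhs])
    show "\<forall>\<^sub>F k in sequentially. box_weight x (r k) / real (r k) ^ d + c * e (r k)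
        \<le> real (m (r k)) / real (r k) ^ d * (greedy_weight x (m (r k)) / real (m (r k)))"
      using rpos
    proof eventually_elim
      case (elim k)
      have "m (r k) > 0"
        using m[OF elim] elim by simp
      then have "real (m (r k)) / real (r k) ^ d * (greedy_weight x (m (r k)) / real (m (r k)))
          = greedy_weight x (m (r k)) / real (r k) ^ d"
        by simp
      moreover have "box_weight x (r k) / real (r k) ^ d + c * e (r k)
          = (box_weight x (r k) + c * real (Suc (d * r k))) / real (r k) ^ d"
        by (simp only: e_def add_divide_distrib times_divide_eq_right)
      moreover have "(box_weight x (r k) + c * real (Suc (d * r k))) / real (r k) ^ d
          \<le> greedy_weight x (m (r k)) / real (r k) ^ d"
        using m[OF elim] by (intro divide_right_mono) auto
      ultimately show ?case
        by argo
    qed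
  qed simp
  then show ?thesis
    by (simp add: l)
qed

section \<open>Almost sure comparison\<close>

theorem corollary1p6:
  fixes M :: "'a measure"
    and X :: "'d::finite site \<Rightarrow> 'a \<Rightarrow> real"
    and F :: "real measure"
    and N G :: real
  assumes dim: "CARD('d) \<ge> 2"
    and prob: "prob_space M"
    and indep: "prob_space.indep_vars M (\<lambda>_. borel) X UNIV"
    and distr_F: "real_distribution F"
    and common: "\<And>v. distr M borel (X v) = F"
    and tail: "(\<integral>\<^sup>+ t \<in> {0..}. ennreal ((1 - cdf F t) powr (1 / real CARD('d))) \<partial>lborel) < \<infinity>"
    and bdd_below: "\<exists>b. AE \<omega> in M. b \<le> X 0 \<omega>"
    and N_lim: "AE \<omega> in M. (\<lambda>n. greedy_weight (\<lambda>v. X v \<omega>) n / real n) \<longlonglongrightarrow> N"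
    and G_lim: "AE \<omega> in M. (\<lambda>n. box_weight (\<lambda>v. X v \<omega>) n / real n ^ CARD('d)) \<longlonglongrightarrow> G"
  shows "AE \<omega> in M. ereal G \<le> box_density (\<lambda>v. X v \<omega>) * ereal N"
proof -
  obtain b where b: "AE \<omega> in M. b \<le> X 0 \<omega>"
    using bdd_below by blast
  have meas: "X v \<in> borel_measurable M" for v
    using indep by (simp add: prob_space.indep_vars_def[OF prob])
  have tr: "(AE \<omega> in M. b \<le> X v \<omega>) \<longleftrightarrow> (AE t in F. b \<le> t)" for v
    using AE_distr_iff[OF meas[of v], of "\<lambda>t. b \<le> t"] unfolding common by simp
  have "AE \<omega> in M. b \<le> X v \<omega>" for v
    using b tr by blast
  then have "AE \<omega> in M. \<forall>v. b \<le> X v \<omega>"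
    by (simp add: AE_all_countable)
  with N_lim G_lim show ?thesis
    by eventually_elim (rule box_density_bound_deterministic[OF dim], auto)
qed

end
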